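(* Let $\mathfrak{h}$ be a finite-dimensional complex vector space with a nondegenerate symmetric bilinear form. If $\omega'\in V_{\widehat{\mathfrak{h}}}(1,0)_2$ is a conformal vector of the vertex algebra $V_{\widehat{\mathfrak{h}}}(1,0)$ whose conformal gradation is the standard gradation $V_{\widehat{\mathfrak{h}}}(1,0)=\bigoplus_{n\ge0}V_{\widehat{\mathfrak{h}}}(1,0)_n$, then $\omega'=\omega_h$ for some $h\in\mathfrak{h}$.
   Context: Everything is over $\mathbb{C}$; $d=\dim\mathfrak{h}$. $\widehat{\mathfrak{h}}=\mathbb{C}[t,t^{-1}]\otimes\mathfrak{h}\oplus\mathbb{C}C$ is the Lie algebra with $C$ central and $[u\otimes t^m,v\otimes t^n]=m\langle u,v\rangle\delta_{m,-n}C$. $V_{\widehat{\mathfrak{h}}}(1,0)=U(\widehat{\mathfrak{h}})\otimes_{U(\widehat{\mathfrak{h}}^{\geq 0})}\mathbb{C}\mathbf{1}$, where $\widehat{\mathfrak{h}}^{\ge 0}=\mathbb{C}[t]\otimes\mathfrak{h}\oplus\mathbb{C}C$ acts on $\mathbb{C}\mathbf{1}$ with $\mathbb{C}[t]\otimes\mathfrak{h}$ acting by $0$ and $C$ by $1$. Write $u(n)$ for the action of $u\otimes t^n$. It has a unique vertex algebra structure with vacuum $\mathbf{1}$ and $Y(u(-1)\mathbf{1},z)=\sum_{n}u(n)z^{-n-1}$. The standard graded piece $V_{\widehat{\mathfrak{h}}}(1,0)_n$ is spanned by the $u_1(-n_1)\cdots u_k(-n_k)\mathbf{1}$ with $k\ge0$,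 $u_i\in\mathfrak{h}$, $n_i\ge1$, $\sum n_i=n$. The conformal gradation of a conformal vector $\omega'$ is the decomposition into eigenspaces of $L'(0)=\omega'_1$, so having the standard gradation means $L'(0)$ acts on $V_{\widehat{\mathfrak{h}}}(1,0)_n$ as $n$ for all $n$. For $h\in\mathfrak{h}$ and an orthonormal basis $h_1,\dots,h_d$, $\omega_h=\frac12\sum_{i=1}^dh_i(-1)^2\mathbf{1}+h(-2)\mathbf{1}$. *)

theory Defs
  imports
    Complex_Main
    "HOL-Library.Poly_Mapping"
    "HOL-Library.Groups_Big_Fun"
begin

section \<open>Complex vector spaces\<close>

class complex_vs = ab_group_add +
  fixes cscale :: "complex \<Rightarrow> 'a \<Rightarrow> 'a" (infixr \<open>*\<^sub>C\<close> 75)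
  assumes cscale_add_right: "c *\<^sub>C (x + y) = c *\<^sub>C x + c *\<^sub>C y"
    and cscale_add_left: "(c + e) *\<^sub>C x = c *\<^sub>C x + e *\<^sub>C x"
    and cscale_cscale: "c *\<^sub>C (e *\<^sub>C x) = (c * e) *\<^sub>C x"
    and cscale_one: "1 *\<^sub>C x = x"

global_interpretation cvs: vector_space "cscale :: complex \<Rightarrow> 'a \<Rightarrow> 'a::complex_vs"
  by unfold_locales (simp_all add: cscale_add_right cscale_add_left cscale_cscale cscale_one)

instantiation complex :: complex_vs
begin
definition cscale_complex :: "complex \<Rightarrow> complex \<Rightarrow> complex"
  where "cscale_complex c x = c * x"
instance
  by standard (simp_all add: cscale_complex_def algebra_simps)
end

instantiation poly_mapping :: (type, complex_vs) complex_vs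
begin
definition cscale_poly_mapping :: "complex \<Rightarrow> ('a \<Rightarrow>\<^sub>0 'b) \<Rightarrow> ('a \<Rightarrow>\<^sub>0 'b)"
  where "cscale_poly_mapping c p = Poly_Mapping.map (cscale c) p"

lemma lookup_cscale [simp]:
  "poly_mapping.lookup (c *\<^sub>C p) k = c *\<^sub>C poly_mapping.lookup p k" for p :: "'a \<Rightarrow>\<^sub>0 'b"
  by (simp add: cscale_poly_mapping_def Poly_Mapping.map.rep_eq when_def)

instance
  by standard (rule poly_mapping_eqI,
    simp add: lookup_add cscale_add_right cscale_add_left cscale_cscale cscale_one)+
end

definition lin_ext :: "('k \<Rightarrow> 'v) \<Rightarrow> ('k \<Rightarrow>\<^sub>0 complex) \<Rightarrow> 'v::complex_vs"
  where "lin_ext f p = (\<Sum>k\<in>Poly_Mapping.keys p. poly_mapping.lookup p k *\<^sub>C f k)"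

lemma lin_ext_superset:
  assumes "finite S" "Poly_Mapping.keys p \<subseteq> S"
  shows "lin_ext f p = (\<Sum>k\<in>S. poly_mapping.lookup p k *\<^sub>C f k)"
  unfolding lin_ext_def
  by (rule sum.mono_neutral_left) (use assms in \<open>auto simp: in_keys_iff\<close>)

lemma lin_ext_add: "lin_ext f (p + q) = lin_ext f p + lin_ext f q"
proof -
  let ?S = "Poly_Mapping.keys p \<union> Poly_Mapping.keys q"
  show ?thesis
    using keys_add[of p q]
    by (simp add: lin_ext_superset[of ?S] lookup_add cscale_add_left sum.distrib)
qed

lemma lin_ext_cscale: "lin_ext f (c *\<^sub>C p) = c *\<^sub>C lin_ext f p"
proof -
  have "Poly_Mapping.keys (c *\<^sub>C p) \<subseteq> Poly_Mapping.keys p"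
    by (auto simp: in_keys_iff cscale_complex_def)
  then show ?thesis
    by (simp add: lin_ext_superset[of "Poly_Mapping.keys p"] cvs.scale_sum_right
        cscale_cscale cscale_complex_def)
qed

lemma lin_ext_single: "lin_ext f (Poly_Mapping.single k c) = c *\<^sub>C f k"
  by (simp add: lin_ext_superset[of "{k}"])

lemma lin_ext_diff: "lin_ext f (p - q) = lin_ext f p - lin_ext f q"
  using lin_ext_add[of f "p - q" q] by (simp add: algebra_simps)


section \<open>Lie algebras and the universal enveloping algebra\<close>

class lie_algebra = complex_vs +
  fixes lie :: "'a \<Rightarrow> 'a \<Rightarrow> 'a"
  assumes lie_add_left: "lie (x + y) z = lie x z + lie y z"
    and lie_add_right: "lie x (y + z) = lie x y + lie x z"
    and lie_cscale_left: "lie (c *\<^sub>C x) y = c *\<^sub>C lie x y"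
    and lie_cscale_right: "lie x (c *\<^sub>C y) = c *\<^sub>C lie x y"
    and lie_self: "lie x x = 0"
    and jacobi: "lie x (lie y z) + lie y (lie z x) + lie z (lie x y) = 0"

text \<open>
  The free monoid on a set, written additively so that \<open>'g word \<Rightarrow>\<^sub>0 complex\<close>, with the
  convolution product of \<^theory>\<open>HOL-Library.Poly_Mapping\<close>, is the free associative algebra.
\<close>

datatype 'g word = Word (letters: "'g list")

instantiation word :: (type) monoid_add
begin
definition zero_word :: "'a word" where "zero_word = Word []"
definition plus_word :: "'a word \<Rightarrow> 'a word \<Rightarrow> 'a word"
  where "plus_word v w = Word (letters v @ letters w)"
instance
  by standard (simp_all add: zero_word_def plus_word_def)
end

inductive_set two_sided_ideal :: "'r::ring_1 set \<Rightarrow> 'r set" for R where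
  ideal_zero: "0 \<in> two_sided_ideal R"
| ideal_gen: "r \<in> R \<Longrightarrow> a * r * b \<in> two_sided_ideal R"
| ideal_add: "p \<in> two_sided_ideal R \<Longrightarrow> q \<in> two_sided_ideal R \<Longrightarrow> p + q \<in> two_sided_ideal R"

lemma ideal_mult_left: "p \<in> two_sided_ideal R \<Longrightarrow> c * p \<in> two_sided_ideal R"
proof (induction rule: two_sided_ideal.induct)
  case (ideal_gen r a b)
  then show ?case
    using two_sided_ideal.ideal_gen[of r R "c * a" b] by (simp add: mult.assoc)
qed (auto simp: distrib_left intro: two_sided_ideal.intros)

lemma ideal_mult_right: "p \<in> two_sided_ideal R \<Longrightarrow> p * c \<in> two_sided_ideal R"
proof (induction rule: two_sided_ideal.induct)
  case (ideal_gen r a b)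
  then show ?case
    using two_sided_ideal.ideal_gen[of r R a "b * c"] by (simp add: mult.assoc)
qed (auto simp: distrib_right intro: two_sided_ideal.intros)

lemma ideal_uminus: "p \<in> two_sided_ideal R \<Longrightarrow> - p \<in> two_sided_ideal R"
  using ideal_mult_left[of p R "- 1"] by simp

lemma ideal_diff:
  "p \<in> two_sided_ideal R \<Longrightarrow> q \<in> two_sided_ideal R \<Longrightarrow> p - q \<in> two_sided_ideal R"
  using ideal_add[OF _ ideal_uminus] by fastforce

definition free_gen :: "'g \<Rightarrow> 'g word \<Rightarrow>\<^sub>0 complex"
  where "free_gen x = Poly_Mapping.single (Word [x]) 1"

text \<open>
  The algebra below is free on the underlying set of the Lie algebra; modulo the first two
  families of relations it is the tensor algebra.
\<close>

definition uea_relations :: "('g::lie_algebra word \<Rightarrow>\<^sub>0 complex) set"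
  where "uea_relations =
      {free_gen (x + y) - free_gen x - free_gen y | x y. True}
    \<union> {free_gen (c *\<^sub>C x) - c *\<^sub>C free_gen x | c x. True}
    \<union> {free_gen x * free_gen y - free_gen y * free_gen x - free_gen (lie x y) | x y. True}"

definition uea_eq :: "('g::lie_algebra word \<Rightarrow>\<^sub>0 complex) \<Rightarrow> ('g word \<Rightarrow>\<^sub>0 complex) \<Rightarrow> bool"
  where "uea_eq p q \<longleftrightarrow> p - q \<in> two_sided_ideal uea_relations"

lemma uea_eq_trans: "uea_eq p q \<Longrightarrow> uea_eq q r \<Longrightarrow> uea_eq p r"
  unfolding uea_eq_def by (drule (1) ideal_add) simp

lemma uea_eq_equivp: "equivp uea_eq"
proof (rule equivpI)
  show "reflp uea_eq"
    by (rule reflpI) (simp add: uea_eq_def ideal_zero)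
  show "symp uea_eq"
    by (rule sympI) (metis uea_eq_def ideal_uminus minus_diff_eq)
  show "transp uea_eq"
    by (rule transpI) (rule uea_eq_trans)
qed

quotient_type (overloaded) 'g uea = "'g::lie_algebra word \<Rightarrow>\<^sub>0 complex" / uea_eq
  by (rule uea_eq_equivp)

lemma cscale_eq_times:
  "c *\<^sub>C p = Poly_Mapping.single 0 c * p" for p :: "'k::monoid_add \<Rightarrow>\<^sub>0 complex"
  unfolding mult_map_scale_conv_mult[symmetric] cscale_poly_mapping_def
  by (simp add: cscale_complex_def[abs_def])

lemma cscale_times_left: "(c *\<^sub>C p) * q = c *\<^sub>C (p * q)"
  for p :: "'k::monoid_add \<Rightarrow>\<^sub>0 complex"
  by (simp add: cscale_eq_times mult.assoc)

instantiation uea :: (lie_algebra) ring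
begin

lift_definition zero_uea :: "'a uea" is 0 .

lift_definition plus_uea :: "'a uea \<Rightarrow> 'a uea \<Rightarrow> 'a uea" is "(+)"
  unfolding uea_eq_def by (drule (1) ideal_add) (simp add: algebra_simps)

lift_definition minus_uea :: "'a uea \<Rightarrow> 'a uea \<Rightarrow> 'a uea" is "(-)"
  unfolding uea_eq_def by (drule (1) ideal_diff) (simp add: algebra_simps)

lift_definition uminus_uea :: "'a uea \<Rightarrow> 'a uea" is uminus
  unfolding uea_eq_def by (drule ideal_uminus) (simp add: algebra_simps)

lift_definition times_uea :: "'a uea \<Rightarrow> 'a uea \<Rightarrow> 'a uea" is "(*)"
proof -
  fix p p' q q' :: "'a word \<Rightarrow>\<^sub>0 complex"
  assume "uea_eq p p'" "uea_eq q q'"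
  then have "(p - p') * q + p' * (q - q') \<in> two_sided_ideal uea_relations"
    unfolding uea_eq_def by (intro ideal_add ideal_mult_left ideal_mult_right)
  then show "uea_eq (p * q) (p' * q')"
    by (simp add: uea_eq_def algebra_simps)
qed

instance
proof
  fix a b c :: "'a uea"
  show "a + b + c = a + (b + c)"
    by (induct a, induct b, induct c) (simp add: plus_uea.abs_eq add.assoc)
  show "a + b = b + a"
    by (induct a, induct b) (simp add: plus_uea.abs_eq add.commute)
  show "0 + a = a"
    by (induct a) (simp add: plus_uea.abs_eq zero_uea_def)
  show "- a + a = 0"
    by (induct a) (simp add: plus_uea.abs_eq zero_uea_def uminus_uea.abs_eq)
  show "a - b = a + - b"
    by (induct a, induct b) (simp add: plus_uea.abs_eq minus_uea.abs_eq uminus_uea.abs_eq)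
  show "a * b * c = a * (b * c)"
    by (induct a, induct b, induct c) (simp add: times_uea.abs_eq mult.assoc)
  show "(a + b) * c = a * c + b * c"
    by (induct a, induct b, induct c) (simp add: times_uea.abs_eq plus_uea.abs_eq distrib_right)
  show "a * (b + c) = a * b + a * c"
    by (induct a, induct b, induct c) (simp add: times_uea.abs_eq plus_uea.abs_eq distrib_left)
qed

end

instantiation uea :: (lie_algebra) complex_vs
begin

lift_definition cscale_uea :: "complex \<Rightarrow> 'a uea \<Rightarrow> 'a uea" is cscale
  unfolding uea_eq_def cvs.scale_right_diff_distrib[symmetric]
  by (simp add: cscale_eq_times ideal_mult_left)

instance
proof
  fix a b :: "'a uea" and c e :: complex
  show "c *\<^sub>C (a + b) = c *\<^sub>C a + c *\<^sub>C b"
    by (induct a, induct b) (simp add: plus_uea.abs_eq cscale_uea.abs_eq cscale_add_right)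
  show "(c + e) *\<^sub>C a = c *\<^sub>C a + e *\<^sub>C a"
    by (induct a) (simp add: plus_uea.abs_eq cscale_uea.abs_eq cscale_add_left)
  show "c *\<^sub>C (e *\<^sub>C a) = (c * e) *\<^sub>C a"
    by (induct a) (simp add: cscale_uea.abs_eq cscale_cscale)
  show "1 *\<^sub>C a = a"
    by (induct a) (simp add: cscale_uea.abs_eq cscale_one)
qed

end

instantiation uea :: (lie_algebra) one
begin
lift_definition one_uea :: "'a uea" is 1 .
instance ..
end

instance uea :: (lie_algebra) monoid_mult
proof
  fix a :: "'a uea"
  show "1 * a = a"
    by (induct a) (simp add: times_uea.abs_eq one_uea_def)
  show "a * 1 = a"
    by (induct a) (simp add: times_uea.abs_eq one_uea_def)
qed

lift_definition uea_gen :: "'g::lie_algebra \<Rightarrow> 'g uea" is free_gen .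

lemma uea_mult_cscale_right: "a * (c *\<^sub>C b) = c *\<^sub>C (a * b)" for a :: "'g::lie_algebra uea"
proof (induct a, induct b)
  fix p q :: "'g word \<Rightarrow>\<^sub>0 complex"
  have "Poly_Mapping.single 0 c * r = r * Poly_Mapping.single 0 c" for r :: "'g word \<Rightarrow>\<^sub>0 complex"
  proof (induction r rule: update_induct)
    case (update r w b)
    have "Poly_Mapping.update w b r = r + Poly_Mapping.single w b"
      using update.hyps by (intro poly_mapping_eqI)
        (auto simp: lookup_update lookup_add lookup_single when_def in_keys_iff)
    then show ?case
      using update.IH by (simp add: distrib_left distrib_right mult_single mult.commute)
  qed simp
  then have "p * (c *\<^sub>C q) = c *\<^sub>C (p * q)"
    by (metis cscale_eq_times mult.assoc)
  then show "abs_uea p * (c *\<^sub>C abs_uea q) = c *\<^sub>C (abs_uea p * abs_uea q)"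
    by (simp add: times_uea.abs_eq cscale_uea.abs_eq)
qed


section \<open>The affine Lie algebra of a space with a symmetric form\<close>

class symmetric_space = complex_vs +
  fixes form :: "'a \<Rightarrow> 'a \<Rightarrow> complex"
  assumes form_add_left: "form (u + v) w = form u w + form v w"
    and form_cscale_left: "form (c *\<^sub>C u) v = c * form u v"
    and form_sym: "form u v = form v u"

lemma form_add_right: "form u (v + w) = form u v + form u w" for u :: "'h::symmetric_space"
  by (metis form_sym form_add_left)

lemma form_cscale_right: "form u (c *\<^sub>C v) = c * form u v" for u :: "'h::symmetric_space"
  by (metis form_sym form_cscale_left)

lemma form_zero_left [simp]: "form 0 u = 0" for u :: "'h::symmetric_space"
  using form_add_left[of 0 0 u] by simp

lemma form_zero_right [simp]: "form u 0 = 0" for u :: "'h::symmetric_space"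
  using form_sym form_zero_left by metis

text \<open>
  \<open>Hhat f c\<close> is \<open>(\<Sum>n. t^n \<otimes> f n) + c C\<close>: a finitely supported function \<open>int \<Rightarrow>\<^sub>0 'h\<close> is an
  element of \<open>\<complex>[t,t\<^sup>-\<^sup>1] \<otimes> \<hh>\<close>.
\<close>

declare [[typedef_overloaded]]

datatype ('h::zero) hhat = Hhat (loop: "int \<Rightarrow>\<^sub>0 'h") (central: complex)

declare [[typedef_overloaded = false]]

instantiation hhat :: (complex_vs) complex_vs
begin
definition zero_hhat :: "'a hhat" where "zero_hhat = Hhat 0 0"
definition plus_hhat :: "'a hhat \<Rightarrow> 'a hhat \<Rightarrow> 'a hhat"
  where "plus_hhat x y = Hhat (loop x + loop y) (central x + central y)"
definition minus_hhat :: "'a hhat \<Rightarrow> 'a hhat \<Rightarrow> 'a hhat"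
  where "minus_hhat x y = Hhat (loop x - loop y) (central x - central y)"
definition uminus_hhat :: "'a hhat \<Rightarrow> 'a hhat"
  where "uminus_hhat x = Hhat (- loop x) (- central x)"
definition cscale_hhat :: "complex \<Rightarrow> 'a hhat \<Rightarrow> 'a hhat"
  where "cscale_hhat c x = Hhat (c *\<^sub>C loop x) (c * central x)"
instance
  by standard
    (simp_all add: zero_hhat_def plus_hhat_def minus_hhat_def uminus_hhat_def cscale_hhat_def
      add.assoc add.commute cscale_add_right cscale_add_left cscale_cscale cscale_one
      distrib_left distrib_right mult.assoc)
end

definition loop_pairing :: "(int \<Rightarrow>\<^sub>0 'h) \<Rightarrow> (int \<Rightarrow>\<^sub>0 'h::symmetric_space) \<Rightarrow> complex"
  where "loop_pairing f g = (\<Sum>m\<in>Poly_Mapping.keys f.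
    of_int m * form (poly_mapping.lookup f m) (poly_mapping.lookup g (- m)))"

lemma loop_pairing_superset:
  assumes "finite S" "Poly_Mapping.keys f \<subseteq> S"
  shows "loop_pairing f g = (\<Sum>m\<in>S.
    of_int m * form (poly_mapping.lookup f m) (poly_mapping.lookup g (- m)))"
  unfolding loop_pairing_def
  by (rule sum.mono_neutral_left) (use assms in \<open>auto simp: in_keys_iff\<close>)

lemma loop_pairing_add_left: "loop_pairing (f + g) h = loop_pairing f h + loop_pairing g h"
proof -
  let ?S = "Poly_Mapping.keys f \<union> Poly_Mapping.keys g"
  show ?thesis
    using keys_add[of f g]
    by (simp add: loop_pairing_superset[of ?S] lookup_add form_add_left distrib_left sum.distrib)
qed

lemma loop_pairing_cscale_left: "loop_pairing (c *\<^sub>C f) g = c * loop_pairing f g"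
proof -
  have "Poly_Mapping.keys (c *\<^sub>C f) \<subseteq> Poly_Mapping.keys f"
    by (auto simp: in_keys_iff)
  then show ?thesis
    by (simp add: loop_pairing_superset[of "Poly_Mapping.keys f"] form_cscale_left
        sum_distrib_left mult.left_commute)
qed

lemma loop_pairing_antisym: "loop_pairing f g = - loop_pairing g f"
proof -
  let ?S = "Poly_Mapping.keys f \<union> uminus ` Poly_Mapping.keys g"
  let ?T = "Poly_Mapping.keys g \<union> uminus ` Poly_Mapping.keys f"
  have "loop_pairing f g =
      (\<Sum>m\<in>?S. of_int m * form (poly_mapping.lookup f m) (poly_mapping.lookup g (- m)))"
    by (rule loop_pairing_superset) auto
  also have "\<dots> =
      (\<Sum>m\<in>?T. - (of_int m * form (poly_mapping.lookup g m) (poly_mapping.lookup f (- m))))"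
    by (rule sum.reindex_bij_witness[of _ uminus uminus]) (auto simp: form_sym)
  also have "\<dots> = - loop_pairing g f"
    unfolding sum_negf by (subst loop_pairing_superset[of ?T]) auto
  finally show ?thesis .
qed

lemma loop_pairing_zero_left [simp]: "loop_pairing 0 g = 0"
  by (simp add: loop_pairing_def)

lemma loop_pairing_zero_right [simp]: "loop_pairing f 0 = 0"
  by (simp add: loop_pairing_def)

instantiation hhat :: (symmetric_space) lie_algebra
begin
definition lie_hhat :: "'a hhat \<Rightarrow> 'a hhat \<Rightarrow> 'a hhat"
  where "lie_hhat x y = Hhat 0 (loop_pairing (loop x) (loop y))"
instance
proof
  fix x y z :: "'a hhat" and c :: complex
  show "lie (x + y) z = lie x z + lie y z"
    by (simp add: lie_hhat_def plus_hhat_def loop_pairing_add_left)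
  show "lie x (y + z) = lie x y + lie x z"
    using loop_pairing_antisym[of "loop x"]
    by (simp add: lie_hhat_def plus_hhat_def loop_pairing_add_left)
  show "lie (c *\<^sub>C x) y = c *\<^sub>C lie x y"
    by (simp add: lie_hhat_def cscale_hhat_def loop_pairing_cscale_left)
  show "lie x (c *\<^sub>C y) = c *\<^sub>C lie x y"
    using loop_pairing_antisym[of "loop x"]
    by (simp add: lie_hhat_def cscale_hhat_def loop_pairing_cscale_left)
  show "lie x x = 0"
    using loop_pairing_antisym[of "loop x" "loop x"]
    by (simp add: lie_hhat_def zero_hhat_def)
  show "lie x (lie y z) + lie y (lie z x) + lie z (lie x y) = 0"
    by (simp add: lie_hhat_def plus_hhat_def zero_hhat_def)
qed
end

definition loop_elem :: "'h \<Rightarrow> int \<Rightarrow> 'h::zero hhat"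
  where "loop_elem u n = Hhat (Poly_Mapping.single n u) 0"

definition central_elem :: "'h::zero hhat"
  where "central_elem = Hhat 0 1"

lemma lie_loop_elem:
  "lie (loop_elem u m) (loop_elem v n) =
    (if m = - n then (of_int m * form u v) *\<^sub>C central_elem else 0)"
  by (subst lie_hhat_def, simp add: loop_elem_def central_elem_def cscale_hhat_def zero_hhat_def
      loop_pairing_superset[of "{m}"] lookup_single when_def)

lemma lie_central_elem: "lie central_elem x = 0" "lie x central_elem = 0"
  by (simp_all add: lie_hhat_def central_elem_def zero_hhat_def)

definition hhat_nonneg :: "'h::zero hhat set"
  where "hhat_nonneg = {x. \<forall>n<0. poly_mapping.lookup (loop x) n = 0}"


section \<open>The induced module\<close>

text \<open>
  The induced module is the tensor product over \<open>U(\<hh>\<^sup>\<ge>\<^sup>0)\<close> of the right module \<open>U(\<hh>)\<close>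
  (hats omitted) with the one-dimensional module on which \<open>x\<close> in the nonnegative part acts as
  \<open>central x\<close>: it is the quotient of the free vector space on the pairs \<open>(a, z)\<close> by the bilinearity
  relations and the balancing relations.  As the nonnegative part generates its enveloping
  algebra, balancing is only imposed for its elements.
\<close>

definition tensor_relations :: "('h::symmetric_space hhat uea \<times> complex \<Rightarrow>\<^sub>0 complex) set"
  where "tensor_relations =
    (let pair = (\<lambda>a z. Poly_Mapping.single (a, z) 1) in
      {pair (a + b) z - pair a z - pair b z | a b z. True}
    \<union> {pair a (y + z) - pair a y - pair a z | a y z. True}
    \<union> {pair (c *\<^sub>C a) z - c *\<^sub>C pair a z | a c z. True}
    \<union> {pair a (c * z) - c *\<^sub>C pair a z | a c z. True}
    \<union> {pair (a * uea_gen x) z - pair a (central x * z) | a x z. x \<in> hhat_nonneg})"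

definition tensor_eq ::
  "('h::symmetric_space hhat uea \<times> complex \<Rightarrow>\<^sub>0 complex)
    \<Rightarrow> ('h hhat uea \<times> complex \<Rightarrow>\<^sub>0 complex) \<Rightarrow> bool"
  where "tensor_eq p q \<longleftrightarrow> p - q \<in> cvs.span tensor_relations"

lemma tensor_eq_trans: "tensor_eq p q \<Longrightarrow> tensor_eq q r \<Longrightarrow> tensor_eq p r"
  unfolding tensor_eq_def by (drule (1) cvs.span_add) simp

lemma tensor_eq_equivp: "equivp tensor_eq"
proof (rule equivpI)
  show "reflp tensor_eq"
    by (rule reflpI) (simp add: tensor_eq_def cvs.span_zero)
  show "symp tensor_eq"
    by (rule sympI) (metis tensor_eq_def cvs.span_neg minus_diff_eq)
  show "transp tensor_eq"
    by (rule transpI) (rule tensor_eq_trans)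
qed

quotient_type (overloaded) 'h fock =
  "'h::symmetric_space hhat uea \<times> complex \<Rightarrow>\<^sub>0 complex" / tensor_eq
  by (rule tensor_eq_equivp)

instantiation fock :: (symmetric_space) complex_vs
begin

lift_definition zero_fock :: "'a fock" is 0 .

lift_definition plus_fock :: "'a fock \<Rightarrow> 'a fock \<Rightarrow> 'a fock" is "(+)"
  unfolding tensor_eq_def by (drule (1) cvs.span_add) (simp add: algebra_simps)

lift_definition minus_fock :: "'a fock \<Rightarrow> 'a fock \<Rightarrow> 'a fock" is "(-)"
  unfolding tensor_eq_def by (drule (1) cvs.span_diff) (simp add: algebra_simps)

lift_definition uminus_fock :: "'a fock \<Rightarrow> 'a fock" is uminus
  unfolding tensor_eq_def by (drule cvs.span_neg) (simp add: algebra_simps)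

lift_definition cscale_fock :: "complex \<Rightarrow> 'a fock \<Rightarrow> 'a fock" is cscale
  unfolding tensor_eq_def cvs.scale_right_diff_distrib[symmetric] by (rule cvs.span_scale)

instance
proof
  fix a b c :: "'a fock" and y z :: complex
  show "a + b + c = a + (b + c)"
    by (induct a, induct b, induct c) (simp add: plus_fock.abs_eq add.assoc)
  show "a + b = b + a"
    by (induct a, induct b) (simp add: plus_fock.abs_eq add.commute)
  show "0 + a = a"
    by (induct a) (simp add: plus_fock.abs_eq zero_fock_def)
  show "- a + a = 0"
    by (induct a) (simp add: plus_fock.abs_eq zero_fock_def uminus_fock.abs_eq)
  show "a - b = a + - b"
    by (induct a, induct b) (simp add: plus_fock.abs_eq minus_fock.abs_eq uminus_fock.abs_eq)
  show "z *\<^sub>C (a + b) = z *\<^sub>C a + z *\<^sub>C b"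
    by (induct a, induct b) (simp add: plus_fock.abs_eq cscale_fock.abs_eq cscale_add_right)
  show "(y + z) *\<^sub>C a = y *\<^sub>C a + z *\<^sub>C a"
    by (induct a) (simp add: plus_fock.abs_eq cscale_fock.abs_eq cscale_add_left)
  show "y *\<^sub>C (z *\<^sub>C a) = (y * z) *\<^sub>C a"
    by (induct a) (simp add: cscale_fock.abs_eq cscale_cscale)
  show "1 *\<^sub>C a = a"
    by (induct a) (simp add: cscale_fock.abs_eq cscale_one)
qed

end

definition fock_tensor :: "'h::symmetric_space hhat uea \<Rightarrow> complex \<Rightarrow> 'h fock"
  where "fock_tensor a z = abs_fock (Poly_Mapping.single (a, z) 1)"

definition fock_vac :: "'h::symmetric_space fock"
  where "fock_vac = fock_tensor 1 1"

lemma tensor_relations_left_mult: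
  assumes "p \<in> tensor_relations"
  shows "lin_ext (\<lambda>(b, z). Poly_Mapping.single (a * b, z) 1) p
    \<in> cvs.span (tensor_relations :: ('h::symmetric_space hhat uea \<times> complex \<Rightarrow>\<^sub>0 complex) set)"
  using assms unfolding tensor_relations_def Let_def
  apply (elim UnE CollectE exE conjE)
  subgoal for b b' z
    by (rule cvs.span_base, simp add: lin_ext_diff lin_ext_single distrib_left, blast)
  subgoal for b y z
    by (rule cvs.span_base, simp add: lin_ext_diff lin_ext_single, blast)
  subgoal for b c z
    by (rule cvs.span_base, simp add: lin_ext_diff lin_ext_cscale lin_ext_single uea_mult_cscale_right, blast)
  subgoal for b c z
    by (rule cvs.span_base, simp add: lin_ext_diff lin_ext_cscale lin_ext_single, blast)
  subgoal for b x z
    by (rule cvs.span_base, simp add: lin_ext_diff lin_ext_single mult.assoc[symmetric], blast)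
  done

text \<open>The left action of the enveloping algebra: \<open>a \<cdot> (b \<otimes> z) = ab \<otimes> z\<close>.\<close>

definition fock_act :: "'h::symmetric_space hhat uea \<Rightarrow> 'h fock \<Rightarrow> 'h fock"
  where "fock_act a v =
    abs_fock (lin_ext (\<lambda>(b, z). Poly_Mapping.single (a * b, z) 1) (rep_fock v))"

lemma fock_act_abs:
  "fock_act a (abs_fock p) = abs_fock (lin_ext (\<lambda>(b, z). Poly_Mapping.single (a * b, z) 1) p)"
proof -
  let ?L = "lin_ext (\<lambda>(b, z). Poly_Mapping.single (a * b, z) (1::complex))"
  have "tensor_eq (rep_fock (abs_fock p)) p"
    by (simp add: fock.abs_eq_iff[symmetric] Quotient3_abs_rep[OF Quotient3_fock])
  then have "rep_fock (abs_fock p) - p \<in> cvs.span tensor_relations"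
    by (simp add: tensor_eq_def)
  then have "?L (rep_fock (abs_fock p) - p) \<in> cvs.span tensor_relations"
    by (induction rule: cvs.span_induct_alt)
      (auto simp: lin_ext_add lin_ext_cscale lin_ext_def[of _ 0] cvs.span_zero
        intro!: cvs.span_add cvs.span_scale tensor_relations_left_mult)
  then show ?thesis
    by (simp add: fock_act_def fock.abs_eq_iff tensor_eq_def lin_ext_diff)
qed

lemma fock_act_tensor: "fock_act a (fock_tensor b z) = fock_tensor (a * b) z"
  by (simp add: fock_tensor_def fock_act_abs lin_ext_single)

definition mode :: "'h \<Rightarrow> int \<Rightarrow> 'h::symmetric_space fock \<Rightarrow> 'h fock"
  where "mode u n = fock_act (uea_gen (loop_elem u n))"

text \<open>The list \<open>[(u\<^sub>1, n\<^sub>1), \<dots>]\<close> stands for the monomial \<open>u\<^sub>1(-n\<^sub>1) \<cdots> 1\<close>.\<close>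

definition fock_degree :: "nat \<Rightarrow> 'h::symmetric_space fock set"
  where "fock_degree n = cvs.span
    {foldr (\<lambda>(u, k). mode u (- int k)) us fock_vac | us :: ('h \<times> nat) list.
      (\<forall>(u, k)\<in>set us. k \<ge> 1) \<and> (\<Sum>(u, k)\<leftarrow>us. k) = n}"


section \<open>Vertex algebras and conformal vectors\<close>

text \<open>
  \<open>Y a n b\<close> is the product \<open>a\<^sub>n b\<close>, that is \<open>Y(a, z) b = (\<Sum>n. a\<^sub>n b z^(-n-1))\<close>.  The last
  condition is the Jacobi identity in components (Borcherds identity); by truncation,
  both sums have finite support.
\<close>

definition vertex_algebra :: "('v \<Rightarrow> int \<Rightarrow> 'v \<Rightarrow> 'v::complex_vs) \<Rightarrow> 'v \<Rightarrow> bool"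
  where "vertex_algebra Y vac \<longleftrightarrow>
    (\<forall>a a' n b. Y (a + a') n b = Y a n b + Y a' n b) \<and>
    (\<forall>a n b b'. Y a n (b + b') = Y a n b + Y a n b') \<and>
    (\<forall>c a n b. Y (c *\<^sub>C a) n b = c *\<^sub>C Y a n b) \<and>
    (\<forall>c a n b. Y a n (c *\<^sub>C b) = c *\<^sub>C Y a n b) \<and>
    (\<forall>a b. \<exists>N. \<forall>n\<ge>N. Y a n b = 0) \<and>
    (\<forall>n b. Y vac n b = (if n = - 1 then b else 0)) \<and>
    (\<forall>a. Y a (- 1) vac = a) \<and>
    (\<forall>a n. n \<ge> 0 \<longrightarrow> Y a n vac = 0) \<and>
    (\<forall>a b c l m n.
      Sum_any (\<lambda>i::nat. ((- 1) ^ i * (of_int l gchoose i)) *\<^sub>C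
        (Y a (m + l - int i) (Y b (n + int i) c)
          - ((- 1) powi l) *\<^sub>C Y b (n + l - int i) (Y a (m + int i) c)))
      = Sum_any (\<lambda>i::nat. (of_int m gchoose i) *\<^sub>C Y (Y a (l + int i) b) (m + n - int i) c))"

text \<open>
  With \<open>L(n) = \<omega>\<^sub>n\<^sub>+\<^sub>1\<close>: the Virasoro relations for some central charge, and
  \<open>Y(L(-1)a, z) = d/dz Y(a, z)\<close>.  No condition on \<open>L(0)\<close> is built in.
\<close>

definition conformal_vector :: "('v \<Rightarrow> int \<Rightarrow> 'v \<Rightarrow> 'v::complex_vs) \<Rightarrow> 'v \<Rightarrow> bool"
  where "conformal_vector Y \<omega> \<longleftrightarrow>
    (\<exists>c. \<forall>m n v.
      Y \<omega> (m + 1) (Y \<omega> (n + 1) v) - Y \<omega> (n + 1) (Y \<omega> (m + 1) v)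
      = of_int (m - n) *\<^sub>C Y \<omega> (m + n + 1) v
        + (if m + n = 0 then (of_int (m ^ 3 - m) / 12 * c) *\<^sub>C v else 0)) \<and>
    (\<forall>a n b. Y (Y \<omega> 0 a) n b = (- of_int n) *\<^sub>C Y a (n - 1) b)"


section \<open>Orthonormal bases and the conformal vectors \<open>\<omega>\<^sub>h\<close>\<close>

definition orthonormal_basis :: "'h::symmetric_space set \<Rightarrow> bool"
  where "orthonormal_basis B \<longleftrightarrow>
    finite B \<and> cvs.independent B \<and> cvs.span B = UNIV \<and>
    (\<forall>b\<in>B. \<forall>b'\<in>B. form b b' = (if b = b' then 1 else 0))"

lemma orthonormal_independent:
  fixes B :: "'h::symmetric_space set"
  assumes "\<forall>b\<in>B. \<forall>b'\<in>B. form b b' = (if b = b' then 1 else 0)"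
  shows "cvs.independent B"
proof
  assume "cvs.dependent B"
  then obtain S c where S: "finite S" "S \<subseteq> B" "(\<Sum>v\<in>S. c v *\<^sub>C v) = 0"
    and "\<exists>v\<in>S. c v \<noteq> 0"
    unfolding cvs.dependent_explicit by blast
  then obtain v where v: "v \<in> S" "c v \<noteq> 0" by blast
  have "form (\<Sum>w\<in>S. c w *\<^sub>C w) v = (\<Sum>w\<in>S. c w * form w v)"
    by (induction S rule: infinite_finite_induct) (simp_all add: form_add_left form_cscale_left)
  also have "\<dots> = (\<Sum>w\<in>S. if w = v then c v else 0)"
  proof (rule sum.cong[OF refl])
    fix w assume "w \<in> S"
    then have "form w v = (if w = v then 1 else 0)" using assms S(2) v(1) by blast
    then show "c w * form w v = (if w = v then c v else 0)" by simp
  qed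
  also have "\<dots> = c v"
    using S(1) v(1) by simp
  finally show False
    using S(3) v(2) by simp
qed

text \<open>So a statement about all orthonormal bases is not vacuous.\<close>

lemma orthonormal_basis_exists:
  assumes fin: "\<exists>B :: 'h::symmetric_space set. finite B \<and> cvs.span B = UNIV"
    and nondeg: "\<And>u :: 'h. (\<forall>v. form u v = 0) \<Longrightarrow> u = 0"
  shows "\<exists>B :: 'h set. orthonormal_basis B"
proof -
  obtain A :: "'h set" where A: "finite A" "cvs.span A = UNIV" using fin by blast
  define Q where "Q B \<longleftrightarrow> (\<forall>b\<in>B. \<forall>b'\<in>B. form b b' = (if b = b' then 1 else 0))"
    for B :: "'h set"
  have bound: "finite B \<and> card B \<le> card A" if "Q B" for B
  proof -
    have "cvs.independent B"
      using that unfolding Q_def by (rule orthonormal_independent)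
    then show ?thesis
      by (rule cvs.independent_span_bound[OF A(1)]) (simp add: A(2))
  qed
  have "\<exists>B. Q B \<and> (\<forall>B'. Q B' \<longrightarrow> card B' \<le> card B)"
  proof (rule ex_has_greatest_nat)
    show "Q {}" by (simp add: Q_def)
    show "\<forall>B. Q B \<longrightarrow> card B < Suc (card A)" using bound by (simp add: less_Suc_eq_le)
  qed
  then obtain B where B: "Q B" "\<And>B'. Q B' \<Longrightarrow> card B' \<le> card B" by blast
  have finB: "finite B" using bound B(1) by blast
  define proj where "proj v = (\<Sum>b\<in>B. form v b *\<^sub>C b)" for v
  have form_sum: "form (\<Sum>b\<in>B. c b *\<^sub>C b) w = (\<Sum>b\<in>B. c b * form b w)" for c w
    using finB by (induction B rule: finite_induct) (simp_all add: form_add_left form_cscale_left)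
  have form_diff: "form (x - y) w = form x w - form y w" for x y w :: 'h
    using form_add_left[of "x - y" y w] by simp
  have perp: "form (v - proj v) b = 0" if "b \<in> B" for v b
  proof -
    have "form (proj v) b = (\<Sum>b'\<in>B. if b' = b then form v b else 0)"
      unfolding proj_def form_sum
    proof (rule sum.cong[OF refl])
      fix b' assume "b' \<in> B"
      then have "form b' b = (if b' = b then 1 else 0)" using B(1) that unfolding Q_def by blast
      then show "form v b' * form b' b = (if b' = b then form v b else 0)" by simp
    qed
    also have "\<dots> = form v b" using finB that by simp
    finally show ?thesis by (simp add: form_diff)
  qed
  have isotropic: "form w w = 0" if w: "\<forall>b\<in>B. form w b = 0" for w
  proof (rule ccontr)
    assume nz: "form w w \<noteq> 0"
    define e where "e = (1 / csqrt (form w w)) *\<^sub>C w"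
    have "form e e = 1"
      using nz power2_csqrt[of "form w w"]
      by (simp add: e_def form_cscale_left form_cscale_right power2_eq_square mult.assoc[symmetric] del: power2_csqrt)
    moreover have e: "form e b = 0" if "b \<in> B" for b
      using w that by (simp add: e_def form_cscale_left)
    moreover have "form b e = 0" if "b \<in> B" for b
      using e[OF that] form_sym[of b e] by simp
    ultimately have "Q (insert e B)" "e \<notin> B"
      using B(1) by (auto simp: Q_def)
    then show False
      using B(2)[of "insert e B"] finB by simp
  qed
  have "v = proj v" for v
  proof -
    let ?w = "v - proj v"
    have "form ?w u = 0" for u
    proof -
      let ?x = "u - proj u"
      have p: "\<forall>b\<in>B. form ?w b = 0" "\<forall>b\<in>B. form ?x b = 0"
        using perp by auto
      then have "\<forall>b\<in>B. form (?w + ?x) b = 0" by (simp add: form_add_left)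
      then have "form (?w + ?x) (?w + ?x) = 0" by (rule isotropic)
      then have wx: "form ?w ?x = 0"
        using isotropic[OF p(1)] isotropic[OF p(2)] form_sym[of ?x ?w]
        by (simp add: form_add_left form_add_right)
      have "form (proj u) ?w = 0"
        unfolding proj_def[of u] form_sum
      proof (intro sum.neutral ballI)
        fix b assume "b \<in> B"
        then have "form b ?w = 0" using p(1) form_sym[of b ?w] by simp
        then show "form u b * form b ?w = 0" by simp
      qed
      then show ?thesis
        using wx form_diff[of u "proj u" ?w] form_sym[of ?x ?w] form_sym[of u ?w] by simp
    qed
    then show ?thesis using nondeg[of ?w] by simp
  qed
  moreover have "proj v \<in> cvs.span B" for v
    unfolding proj_def by (intro cvs.span_sum cvs.span_scale cvs.span_base)
  ultimately have "cvs.span B = UNIV" by (metis UNIV_eq_I)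
  then have "orthonormal_basis B"
    using finB B(1) orthonormal_independent unfolding orthonormal_basis_def Q_def by blast
  then show ?thesis by blast
qed

definition omega :: "'h set \<Rightarrow> 'h \<Rightarrow> 'h::symmetric_space fock"
  where "omega B h =
    (1 / 2) *\<^sub>C (\<Sum>b\<in>B. mode b (- 1) (mode b (- 1) fock_vac)) + mode h (- 2) fock_vac"

end

theory Submission
  imports Defs
begin

text \<open>
  Write \<open>\<omega>'\<close> as a quadratic part, a combination of vectors \<open>u(-1)v(-1)1\<close>, plus a linear part
  \<open>h(-2)1\<close>.  This \<open>h\<close> is the vector in the conclusion, and the claim becomes that the quadratic
  part equals \<open>1/2 \<Sum> b(-1)\<^sup>2 1\<close> for every orthonormal basis.

  The gradation is used in degree one.  By the commutator formula of the vertex algebra,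
  \<open>[u(-1), \<omega>'\<^sub>1] 1 = \<Sum>\<^sub>i (-1 choose i) (u(i)\<omega>')\<^bsub>-i\<^esub> 1\<close>.
  The left side is \<open>-u(-1)1\<close>, because \<open>\<omega>'\<^sub>1\<close> kills the vacuum and fixes \<open>u(-1)1\<close>.  On the right
  side \<open>i = 0\<close> contributes nothing, nor does \<open>i \<ge> 2\<close>, where \<open>u(i)\<omega>'\<close> is a multiple of the vacuum,
  and \<open>i = 1\<close> contributes \<open>-u(1)\<omega>'\<close>.  Hence \<open>u(1)\<omega>' = u(-1)1\<close> for every \<open>u\<close>
  (\<open>mode_1_eq_mode_minus_1\<close>).

  Now apply the Euler operator \<open>E = \<Sum> b(-1)b(1)\<close> to \<open>\<omega>'\<close>.  As \<open>b(1)\<close> acts like the derivative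
  with respect to \<open>b(-1)\<close>, \<open>E\<close> doubles the quadratic part and kills the linear one, so that
  \<open>\<omega>' = 1/2 E\<omega>' + h(-2)1\<close> (\<open>fock_degree_2_expansion\<close>).  By the previous paragraph
  \<open>E\<omega>' = \<Sum> b(-1)b(-1)1\<close>, and the two together give the theorem.
\<close>

section \<open>The enveloping algebra\<close>

lemma poly_mapping_induct [case_names zero add_single]:
  fixes p :: "'k \<Rightarrow>\<^sub>0 'b::monoid_add"
  assumes "P 0" and "\<And>p k c. P p \<Longrightarrow> P (p + Poly_Mapping.single k c)"
  shows "P p"
proof (induction p rule: update_induct)
  case (update p k c)
  have "Poly_Mapping.update k c p = p + Poly_Mapping.single k c"
    using update.hyps by (intro poly_mapping_eqI)
      (auto simp: lookup_update lookup_add lookup_single when_def in_keys_iff)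
  then show ?case
    using update.IH assms(2) by simp
qed (rule assms(1))

lemma uea_relationD:
  assumes "p - q \<in> uea_relations"
  shows "abs_uea p = abs_uea q"
  using ideal_gen[OF assms, of 1 1] by (simp add: uea.abs_eq_iff uea_eq_def)

lemma uea_gen_add: "uea_gen (x + y) = uea_gen x + uea_gen y"
  unfolding uea_gen.abs_eq plus_uea.abs_eq
  by (rule uea_relationD) (unfold uea_relations_def diff_diff_eq[symmetric], blast)

lemma uea_gen_cscale: "uea_gen (c *\<^sub>C x) = c *\<^sub>C uea_gen x"
  unfolding uea_gen.abs_eq cscale_uea.abs_eq
  by (rule uea_relationD) (unfold uea_relations_def, blast)

lemma uea_gen_zero: "uea_gen 0 = 0"
  using uea_gen_add[of 0 0] by simp

lemma uea_gen_commutator: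
  "uea_gen x * uea_gen y = uea_gen y * uea_gen x + uea_gen (lie x y)"
proof -
  have "uea_gen x * uea_gen y - uea_gen y * uea_gen x = uea_gen (lie x y)"
    unfolding uea_gen.abs_eq times_uea.abs_eq minus_uea.abs_eq
    by (rule uea_relationD) (unfold uea_relations_def, blast)
  then show ?thesis
    by (simp add: algebra_simps)
qed

lemma uea_mult_cscale_left: "(c *\<^sub>C a) * b = c *\<^sub>C (a * b)" for a :: "'g::lie_algebra uea"
  by (induct a, induct b) (simp add: times_uea.abs_eq cscale_uea.abs_eq cscale_times_left)

text \<open>
  Multiplication by generators on the left alone suffices: a monomial is built up by adding
  letters in front of the empty word.
\<close>

lemma uea_induct [case_names add scalar gen_mult]:
  fixes a :: "'g::lie_algebra uea"
  assumes add: "\<And>a b. P a \<Longrightarrow> P b \<Longrightarrow> P (a + b)"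
    and scalar: "\<And>c. P (c *\<^sub>C 1)"
    and gen_mult: "\<And>x a. P a \<Longrightarrow> P (uea_gen x * a)"
  shows "P a"
proof (induct a)
  fix p :: "'g word \<Rightarrow>\<^sub>0 complex"
  have monomial: "P (abs_uea (Poly_Mapping.single (Word xs) c))" for xs c
  proof (induction xs)
    case Nil
    have "Poly_Mapping.single (Word []) c = c *\<^sub>C (1 :: 'g word \<Rightarrow>\<^sub>0 complex)"
      by (simp add: cscale_eq_times zero_word_def)
    then show ?case
      using scalar[of c] by (simp add: one_uea_def cscale_uea.abs_eq)
  next
    case (Cons x xs)
    have "Poly_Mapping.single (Word (x # xs)) c = free_gen x * Poly_Mapping.single (Word xs) c"
      by (simp add: free_gen_def mult_single plus_word_def)
    then show ?case
      using gen_mult[OF Cons, of x] by (simp add: uea_gen.abs_eq times_uea.abs_eq)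
  qed
  show "P (abs_uea p)"
  proof (induction p rule: poly_mapping_induct)
    case zero
    show ?case using scalar[of 0] by (simp add: zero_uea_def)
  next
    case (add_single p w c)
    then show ?case
      using add[OF _ monomial, of "abs_uea p" "letters w" c] by (simp add: plus_uea.abs_eq)
  qed
qed

lemma uea_gen_central:
  assumes "\<And>x. lie z x = 0"
  shows "uea_gen z * a = a * uea_gen z"
proof (induction a rule: uea_induct)
  case (gen_mult x a)
  have "uea_gen z * uea_gen x = uea_gen x * uea_gen z"
    using uea_gen_commutator[of z x] assms by (simp add: uea_gen_zero)
  then show ?case
    using gen_mult by (metis mult.assoc)
qed (simp_all add: distrib_left distrib_right uea_mult_cscale_left uea_mult_cscale_right)

section \<open>The modes on the induced module\<close>

lemma tensor_relationD:
  "p - q \<in> tensor_relations \<Longrightarrow> abs_fock p = abs_fock q"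
  by (simp add: fock.abs_eq_iff tensor_eq_def cvs.span_base)

lemma fock_tensor_add_left: "fock_tensor (a + b) z = fock_tensor a z + fock_tensor b z"
  unfolding fock_tensor_def plus_fock.abs_eq
  by (rule tensor_relationD) (unfold tensor_relations_def Let_def diff_diff_eq[symmetric], blast)

lemma fock_tensor_cscale_left: "fock_tensor (c *\<^sub>C a) z = c *\<^sub>C fock_tensor a z"
  unfolding fock_tensor_def cscale_fock.abs_eq
  by (rule tensor_relationD) (unfold tensor_relations_def Let_def, blast)

lemma fock_tensor_cscale_right: "fock_tensor a (c * z) = c *\<^sub>C fock_tensor a z"
  unfolding fock_tensor_def cscale_fock.abs_eq
  by (rule tensor_relationD) (unfold tensor_relations_def Let_def, blast)

lemma fock_tensor_balanced:
  "x \<in> hhat_nonneg \<Longrightarrow> fock_tensor (a * uea_gen x) z = fock_tensor a (central x * z)"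
  unfolding fock_tensor_def
  by (rule tensor_relationD) (unfold tensor_relations_def Let_def, blast)

text \<open>Scalars need no case of their own, since they can be moved into the left tensor factor.\<close>

lemma fock_induct [case_names add tensor]:
  assumes add: "\<And>v w. P v \<Longrightarrow> P w \<Longrightarrow> P (v + w)" and tensor: "\<And>a z. P (fock_tensor a z)"
  shows "P v"
proof (induct v)
  fix p :: "'a hhat uea \<times> complex \<Rightarrow>\<^sub>0 complex"
  show "P (abs_fock p)"
  proof (induction p rule: poly_mapping_induct)
    case zero
    have "fock_tensor 0 0 = (0 :: 'a fock)"
      using fock_tensor_cscale_right[of 0 0 0] by simp
    then show ?case using tensor[of 0 0] by (simp add: zero_fock_def)
  next
    case (add_single p k c)
    obtain a z where k: "k = (a, z)" by (cases k)
    have "Poly_Mapping.single k c = c *\<^sub>C Poly_Mapping.single k 1"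
      by (rule poly_mapping_eqI) (simp add: lookup_single when_def cscale_complex_def)
    then have "abs_fock (Poly_Mapping.single k c) = fock_tensor (c *\<^sub>C a) z"
      by (simp add: k fock_tensor_cscale_left) (simp add: fock_tensor_def cscale_fock.abs_eq)
    then show ?case
      using add[OF add_single tensor[of "c *\<^sub>C a" z]] by (metis plus_fock.abs_eq)
  qed
qed

lemma fock_act_add_right: "fock_act a (v + w) = fock_act a v + fock_act a w"
  by (induct v, induct w) (simp add: plus_fock.abs_eq fock_act_abs lin_ext_add)

lemma fock_act_cscale_right: "fock_act a (c *\<^sub>C v) = c *\<^sub>C fock_act a v"
  by (induct v) (simp add: cscale_fock.abs_eq fock_act_abs lin_ext_cscale)

lemma fock_act_add_left: "fock_act (a + b) v = fock_act a v + fock_act b v"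
  by (induction v rule: fock_induct)
    (simp_all add: fock_act_add_right fock_act_tensor distrib_right fock_tensor_add_left)

lemma fock_act_cscale_left: "fock_act (c *\<^sub>C a) v = c *\<^sub>C fock_act a v"
  by (induction v rule: fock_induct)
    (simp_all add: fock_act_add_right fock_act_tensor uea_mult_cscale_left
      fock_tensor_cscale_left cscale_add_right)

lemma fock_act_mult: "fock_act (a * b) v = fock_act a (fock_act b v)"
  by (induction v rule: fock_induct)
    (simp_all add: fock_act_add_right fock_act_tensor mult.assoc)

text \<open>
  Being central, \<open>C\<close> can be moved to the right end of \<open>a\<close> in \<open>a \<otimes> z\<close>; there it crosses the tensor
  sign, and on the one-dimensional module it acts as \<open>1\<close>.
\<close>

lemma fock_act_central: "fock_act (uea_gen central_elem) v = v" for v :: "'h::symmetric_space fock"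
proof (induction v rule: fock_induct)
  case (tensor a z)
  have "uea_gen central_elem * a = a * uea_gen central_elem"
    by (rule uea_gen_central) (rule lie_central_elem)
  then have "fock_act (uea_gen central_elem) (fock_tensor a z)
      = fock_tensor (a * uea_gen central_elem) z"
    by (simp only: fock_act_tensor)
  also have "\<dots> = fock_tensor a (central (central_elem :: 'h hhat) * z)"
    by (rule fock_tensor_balanced) (simp add: hhat_nonneg_def central_elem_def)
  finally show ?case
    by (simp add: central_elem_def)
qed (simp add: fock_act_add_right)

lemma loop_elem_add: "loop_elem (u + v) n = loop_elem u n + loop_elem v n"
  by (simp add: loop_elem_def plus_hhat_def single_add)

lemma loop_elem_cscale: "loop_elem (c *\<^sub>C u) n = c *\<^sub>C loop_elem u n"
  unfolding loop_elem_def cscale_hhat_def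
  by (auto intro!: poly_mapping_eqI simp: lookup_single when_def)

lemma mode_add_right: "mode u n (v + w) = mode u n v + mode u n w"
  by (simp add: mode_def fock_act_add_right)

lemma mode_cscale_right: "mode u n (c *\<^sub>C v) = c *\<^sub>C mode u n v"
  by (simp add: mode_def fock_act_cscale_right)

lemma mode_zero_right: "mode u n 0 = 0"
  using mode_cscale_right[of u n 0 0] by simp

lemma mode_add_left: "mode (u + v) n w = mode u n w + mode v n w"
  by (simp add: mode_def loop_elem_add uea_gen_add fock_act_add_left)

lemma mode_cscale_left: "mode (c *\<^sub>C u) n w = c *\<^sub>C mode u n w"
  by (simp add: mode_def loop_elem_cscale uea_gen_cscale fock_act_cscale_left)

lemma mode_zero_left: "mode 0 n w = 0"
  using mode_cscale_left[of 0 0 n w] by simp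

lemma mode_sum_left: "mode (\<Sum>i\<in>I. f i) n w = (\<Sum>i\<in>I. mode (f i) n w)"
  by (induction I rule: infinite_finite_induct) (simp_all add: mode_zero_left mode_add_left)

text \<open>
  The Heisenberg relations, oriented so that annihilation operators can be moved to the right
  until they meet the vacuum.
\<close>

lemma mode_commutator:
  "mode u m (mode v n w) = mode v n (mode u m w)
    + (if m = - n then (of_int m * form u v) *\<^sub>C w else 0)"
proof -
  have "mode u m (mode v n w) = mode v n (mode u m w)
      + fock_act (uea_gen (lie (loop_elem u m) (loop_elem v n))) w"
    unfolding mode_def fock_act_mult[symmetric] fock_act_add_left[symmetric]
    by (simp only: uea_gen_commutator[of "loop_elem u m" "loop_elem v n"])
  moreover have "fock_act (uea_gen (c *\<^sub>C central_elem)) w = c *\<^sub>C w" for c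
    by (simp add: uea_gen_cscale fock_act_cscale_left fock_act_central)
  from this[of 0] this have "fock_act (uea_gen (lie (loop_elem u m) (loop_elem v n))) w
      = (if m = - n then (of_int m * form u v) *\<^sub>C w else 0)"
    by (auto simp only: lie_loop_elem cvs.scale_zero_left split: if_split)
  ultimately show ?thesis
    by simp
qed

lemma mode_nonneg_vac:
  assumes "n \<ge> 0"
  shows "mode u n fock_vac = 0"
proof -
  have "loop_elem u n \<in> hhat_nonneg"
    using assms by (simp add: hhat_nonneg_def loop_elem_def lookup_single when_def)
  from fock_tensor_balanced[OF this, of 1 1] have "mode u n fock_vac = fock_tensor 1 0"
    by (simp add: mode_def fock_vac_def fock_act_tensor) (simp add: loop_elem_def)
  then show ?thesis
    using fock_tensor_cscale_right[of 1 0 0] by simp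
qed

section \<open>The degree two part\<close>

lemma fock_degree_1I: "mode u (- 1) fock_vac \<in> fock_degree 1"
  unfolding fock_degree_def
  by (rule cvs.span_base, rule CollectI, rule exI[of _ "[(u, 1)]"]) simp

text \<open>The two kinds of monomials are the two partitions \<open>1 + 1\<close> and \<open>2\<close> of the degree.\<close>

lemma fock_degree_2_induct [consumes 1, case_names zero quadratic linear]:
  fixes w :: "'h::symmetric_space fock"
  assumes "w \<in> fock_degree 2"
    and zero: "P 0"
    and quadratic: "\<And>c u v w. P w \<Longrightarrow> P (c *\<^sub>C mode u (- 1) (mode v (- 1) fock_vac) + w)"
    and linear: "\<And>c u w. P w \<Longrightarrow> P (c *\<^sub>C mode u (- 2) fock_vac + w)"
  shows "P w"
  using assms(1) unfolding fock_degree_def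
proof (induction rule: cvs.span_induct_alt)
  case base
  show ?case by (rule zero)
next
  case (step c x w)
  then obtain us :: "('h \<times> nat) list" where us: "\<forall>(u, k)\<in>set us. k \<ge> 1" "(\<Sum>(u, k)\<leftarrow>us. k) = 2"
    and x: "x = foldr (\<lambda>(u, k). mode u (- int k)) us fock_vac"
    by blast
  consider u where "us = [(u, 2)]" | u v where "us = [(u, 1), (v, 1)]"
  proof (cases us)
    case Nil
    then show ?thesis using us by simp
  next
    case us1: (Cons p us')
    obtain u k where p: "p = (u, k)" by (cases p)
    show ?thesis
    proof (cases us')
      case Nil
      then show ?thesis using us us1 p that(1) by simp
    next
      case us2: (Cons q us'')
      obtain v l where q: "q = (v, l)" by (cases q)
      have "k + (l + (\<Sum>(u, k)\<leftarrow>us''. k)) = 2" "k \<ge> 1" "l \<ge> 1"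
        using us us1 us2 p q by simp_all
      then have kl: "k = 1" "l = 1" "(\<Sum>(u, k)\<leftarrow>us''. k) = 0"
        by linarith+
      then have "us'' = []"
        using us(1) us1 us2 by (cases us'') auto
      then show ?thesis using us1 us2 p q kl that(2) by simp
    qed
  qed
  then show ?case
    using x quadratic[OF step(2)] linear[OF step(2)] by cases auto
qed

text \<open>
  The operator \<open>u(n)\<close> lowers the degree by \<open>n\<close>, and in degrees \<open>\<le> 0\<close> there is nothing but multiples
  of the vacuum.
\<close>

lemma mode_ge_2_degree_2:
  assumes "w \<in> fock_degree 2" "n \<ge> 2"
  shows "\<exists>c. mode u n w = c *\<^sub>C fock_vac"
  using assms(1)
proof (induction rule: fock_degree_2_induct)
  case zero
  show ?case by (rule exI[of _ 0]) (simp add: mode_zero_right)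
next
  case (quadratic c v v' w)
  then show ?case
    using assms(2) mode_commutator[of u n v "- 1"] mode_commutator[of u n v' "- 1"]
    by (simp add: mode_add_right mode_cscale_right mode_nonneg_vac mode_zero_right)
next
  case (linear c v w)
  then obtain e where e: "mode u n w = e *\<^sub>C fock_vac" by blast
  have "mode u n (mode v (- 2) fock_vac) = (if n = 2 then of_int n * form u v else 0) *\<^sub>C fock_vac"
    using assms(2) mode_commutator[of u n v "- 2"] by (simp add: mode_nonneg_vac mode_zero_right)
  then show ?case
    by (simp only: mode_add_right mode_cscale_right e cscale_cscale cscale_add_left[symmetric]) blast
qed

lemma orthonormal_expansion:
  assumes "orthonormal_basis B"
  shows "(\<Sum>b\<in>B. form b u *\<^sub>C b) = u"
proof -
  have B: "finite B" "\<And>b b'. b \<in> B \<Longrightarrow> b' \<in> B \<Longrightarrow> form b b' = (if b = b' then 1 else 0)"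
    using assms by (auto simp: orthonormal_basis_def)
  have "u \<in> cvs.span B"
    using assms by (simp add: orthonormal_basis_def)
  then show ?thesis
  proof (induction rule: cvs.span_induct_alt)
    case base
    show ?case by simp
  next
    case (step c b' u)
    have "(\<Sum>b\<in>B. form b b' *\<^sub>C b) = (\<Sum>b\<in>B. if b = b' then b' else 0)"
      by (rule sum.cong) (auto simp: B(2) step(1))
    also have "\<dots> = b'"
      using B(1) step(1) by simp
    finally have basis: "(\<Sum>b\<in>B. form b b' *\<^sub>C b) = b'" .
    have "(\<Sum>b\<in>B. form b (c *\<^sub>C b' + u) *\<^sub>C b)
        = (\<Sum>b\<in>B. c *\<^sub>C (form b b' *\<^sub>C b) + form b u *\<^sub>C b)"
      by (simp only: form_add_right form_cscale_right cscale_add_left cscale_cscale)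
    also have "\<dots> = c *\<^sub>C b' + u"
      by (simp only: sum.distrib cvs.scale_sum_right[symmetric] basis step(2))
    finally show ?case .
  qed
qed

text \<open>
  In the polynomial variables \<open>b(-1)\<close>, \<open>b(-2)\<close>, \<dots>, the mode \<open>b(1)\<close> is differentiation by \<open>b(-1)\<close>
  for a vector \<open>b\<close> of an orthonormal basis, so this operator counts the factors \<open>b(-1)\<close>.
\<close>

definition euler :: "'h set \<Rightarrow> 'h::symmetric_space fock \<Rightarrow> 'h fock"
  where "euler B w = (\<Sum>b\<in>B. mode b (- 1) (mode b 1 w))"

lemma euler_add: "euler B (v + w) = euler B v + euler B w"
  by (simp add: euler_def mode_add_right sum.distrib)

lemma euler_cscale: "euler B (c *\<^sub>C w) = c *\<^sub>C euler B w"
  by (simp add: euler_def mode_cscale_right cvs.scale_sum_right)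

lemma euler_linear: "euler B (mode u (- 2) fock_vac) = 0"
  by (simp add: euler_def mode_commutator[of _ 1 u "- 2"] mode_nonneg_vac mode_zero_right)

lemma euler_quadratic:
  assumes "orthonormal_basis B"
  shows "euler B (mode u (- 1) (mode v (- 1) fock_vac))
    = 2 *\<^sub>C mode u (- 1) (mode v (- 1) fock_vac)"
proof -
  have contract: "(\<Sum>b\<in>B. form b x *\<^sub>C mode b n w) = mode x n w" for x n w
    using orthonormal_expansion[OF assms, of x] mode_sum_left[of "\<lambda>b. form b x *\<^sub>C b" B n w]
    by (simp add: mode_cscale_left)
  have "mode b 1 (mode u (- 1) (mode v (- 1) fock_vac))
      = form b v *\<^sub>C mode u (- 1) fock_vac + form b u *\<^sub>C mode v (- 1) fock_vac" for b
    using mode_commutator[of b 1 u "- 1"] mode_commutator[of b 1 v "- 1"]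
    by (simp add: mode_nonneg_vac mode_zero_right mode_add_right mode_cscale_right)
  then have "euler B (mode u (- 1) (mode v (- 1) fock_vac))
      = mode v (- 1) (mode u (- 1) fock_vac) + mode u (- 1) (mode v (- 1) fock_vac)"
    by (simp add: euler_def mode_add_right mode_cscale_right sum.distrib contract)
  also have "mode v (- 1) (mode u (- 1) fock_vac) = mode u (- 1) (mode v (- 1) fock_vac)"
    using mode_commutator[of v "- 1" u "- 1"] by simp
  finally show ?thesis
    using cscale_add_left[of 1 1 "mode u (- 1) (mode v (- 1) fock_vac)"] by (simp add: cscale_one)
qed

text \<open>
  The quadratic part of \<open>w\<close> is \<open>1/2 E w\<close>, because the Euler operator doubles it and kills the
  linear part.  The vector \<open>h\<close> is read off from the linear part before any basis is chosen,
  hence the order of the quantifiers.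
\<close>

lemma fock_degree_2_expansion:
  assumes "w \<in> fock_degree 2"
  shows "\<exists>h. \<forall>B. orthonormal_basis B \<longrightarrow> w = (1 / 2) *\<^sub>C euler B w + mode h (- 2) fock_vac"
  using assms
proof (induction rule: fock_degree_2_induct)
  case zero
  have "euler B 0 = (0 :: 'a fock)" for B
    using euler_cscale[of B 0 0] by simp
  then show ?case by (intro exI[of _ 0]) (simp add: mode_zero_left)
next
  case (quadratic c u v w)
  then obtain h where
    h: "(1 / 2) *\<^sub>C euler B w + mode h (- 2) fock_vac = w" if "orthonormal_basis B" for B
    by metis
  show ?case
  proof (intro exI[of _ h] allI impI)
    fix B :: "'a set" assume B: "orthonormal_basis B"
    show "c *\<^sub>C mode u (- 1) (mode v (- 1) fock_vac) + w
        = (1 / 2) *\<^sub>C euler B (c *\<^sub>C mode u (- 1) (mode v (- 1) fock_vac) + w)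
          + mode h (- 2) fock_vac"
      by (simp add: euler_add euler_cscale euler_quadratic[OF B] cscale_add_right cscale_cscale
          add.assoc h[OF B])
  qed
next
  case (linear c u w)
  then obtain h where
    h: "(1 / 2) *\<^sub>C euler B w + mode h (- 2) fock_vac = w" if "orthonormal_basis B" for B
    by metis
  show ?case
  proof (intro exI[of _ "c *\<^sub>C u + h"] allI impI)
    fix B :: "'a set" assume B: "orthonormal_basis B"
    show "c *\<^sub>C mode u (- 2) fock_vac + w
        = (1 / 2) *\<^sub>C euler B (c *\<^sub>C mode u (- 2) fock_vac + w)
          + mode (c *\<^sub>C u + h) (- 2) fock_vac"
      by (simp add: euler_add euler_cscale euler_linear mode_add_left mode_cscale_left
          add.left_commute h[OF B])
  qed
qed

section \<open>The gradation determines the quadratic part\<close>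

text \<open>
  This is the Borcherds identity at \<open>l = 0\<close>, where the coefficients \<open>0 choose i\<close> leave only the
  term \<open>i = 0\<close> on the left.
\<close>

lemma vertex_algebra_commutator:
  assumes "vertex_algebra Y vac"
  shows "Y a m (Y b n c) - Y b n (Y a m c)
    = Sum_any (\<lambda>i::nat. (of_int m gchoose i) *\<^sub>C Y (Y a (int i) b) (m + n - int i) c)"
proof -
  let ?f = "\<lambda>i::nat. ((- 1) ^ i * (of_int 0 gchoose i :: complex)) *\<^sub>C
        (Y a (m + 0 - int i) (Y b (n + int i) c)
          - ((- 1) powi 0) *\<^sub>C Y b (n + 0 - int i) (Y a (m + int i) c))"
  have "?f i = 0" if "i \<noteq> 0" for i
    using that by (cases i) simp_all
  then have "{i. ?f i \<noteq> 0} \<subseteq> {0}" by blast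
  then have "Sum_any ?f = Y a m (Y b n c) - Y b n (Y a m c)"
    by (subst Sum_any.expand_superset[of "{0}"]) (simp_all add: cscale_one)
  moreover have "Sum_any ?f
      = Sum_any (\<lambda>i::nat. (of_int m gchoose i) *\<^sub>C Y (Y a (0 + int i) b) (m + n - int i) c)"
    using assms unfolding vertex_algebra_def by blast
  ultimately show ?thesis by simp
qed

text \<open>
  Here the action of \<open>w\<^sub>1\<close> on degree one is turned into a statement about \<open>w\<close> itself, by
  commuting \<open>w\<^sub>1\<close> with \<open>u(-1)\<close> on the vacuum.  The mode \<open>-i\<close> of a multiple of the vacuum vanishes
  unless \<open>i = 1\<close>, and a nonnegative mode kills the vacuum, so one term of the commutator formula
  survives.
\<close>

lemma mode_1_eq_mode_minus_1:
  fixes Y :: "'h::symmetric_space fock \<Rightarrow> int \<Rightarrow> 'h fock \<Rightarrow> 'h fock"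
  assumes va: "vertex_algebra Y fock_vac"
    and generating_fields: "\<And>u n v. Y (mode u (- 1) fock_vac) n v = mode u n v"
    and w: "w \<in> fock_degree 2"
    and degree_one: "Y w 1 (mode u (- 1) fock_vac) = mode u (- 1) fock_vac"
  shows "mode u 1 w = mode u (- 1) fock_vac"
proof -
  have "(\<forall>c a n b. Y (c *\<^sub>C a) n b = c *\<^sub>C Y a n b) \<and>
      (\<forall>n b. Y fock_vac n b = (if n = - 1 then b else 0)) \<and>
      (\<forall>a. Y a (- 1) fock_vac = a) \<and> (\<forall>a n. n \<ge> 0 \<longrightarrow> Y a n fock_vac = 0)"
    using va unfolding vertex_algebra_def by (elim conjE) (intro conjI; assumption)
  then have Y_scale: "Y (c *\<^sub>C a) n b = c *\<^sub>C Y a n b"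
    and Y_vac: "Y fock_vac n b = (if n = - 1 then b else 0)"
    and Y_creation: "Y a (- 1) fock_vac = a"
    and Y_nonneg_vac: "n \<ge> 0 \<Longrightarrow> Y a n fock_vac = 0" for a b c n
    by simp_all
  let ?f = "\<lambda>i::nat. ((- 1 :: complex) gchoose i) *\<^sub>C Y (mode u (int i) w) (- int i) fock_vac"
  have "?f i = 0" if "i \<noteq> 1" for i
  proof (cases "i = 0")
    case True
    then show ?thesis by (simp add: Y_nonneg_vac)
  next
    case False
    then have i: "int i \<ge> 2" using that by simp
    then obtain c where "mode u (int i) w = c *\<^sub>C fock_vac"
      using mode_ge_2_degree_2[OF w] by blast
    then show ?thesis using i by (simp add: Y_scale Y_vac)
  qed
  then have "{i. ?f i \<noteq> 0} \<subseteq> {1}" by blast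
  then have "Sum_any ?f = - mode u 1 w"
    by (subst Sum_any.expand_superset[of "{1}"]) (simp_all add: Y_creation cscale_one)
  moreover have "mode u (- 1) (Y w 1 fock_vac) - Y w 1 (mode u (- 1) fock_vac) = Sum_any ?f"
    using vertex_algebra_commutator[OF va, of "mode u (- 1) fock_vac" "- 1" w 1 fock_vac]
    by (simp add: generating_fields)
  ultimately show ?thesis
    by (simp add: degree_one Y_nonneg_vac mode_zero_right)
qed

theorem proposition3p1:
  fixes Y :: "'h::symmetric_space fock \<Rightarrow> int \<Rightarrow> 'h fock \<Rightarrow> 'h fock"
    and \<omega>' :: "'h fock"
  assumes finite_dim: "\<exists>B :: 'h set. finite B \<and> cvs.span B = UNIV"
    and nondegenerate: "\<And>u :: 'h. (\<forall>v. form u v = 0) \<Longrightarrow> u = 0"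
    and va: "vertex_algebra Y fock_vac"
    and generating_fields: "\<And>u n v. Y (mode u (- 1) fock_vac) n v = mode u n v"
    and degree_two: "\<omega>' \<in> fock_degree 2"
    and conformal: "conformal_vector Y \<omega>'"
    and standard_gradation: "\<And>n v. v \<in> fock_degree n \<Longrightarrow> Y \<omega>' 1 v = of_nat n *\<^sub>C v"
  shows "\<exists>h. \<forall>B. orthonormal_basis B \<longrightarrow> \<omega>' = omega B h"
proof -
  have "mode u 1 \<omega>' = mode u (- 1) fock_vac" for u
  proof (rule mode_1_eq_mode_minus_1[OF va generating_fields degree_two])
    show "Y \<omega>' 1 (mode u (- 1) fock_vac) = mode u (- 1) fock_vac"
      using standard_gradation[OF fock_degree_1I] by (simp add: cscale_one)
  qed
  then have "euler B \<omega>' = (\<Sum>b\<in>B. mode b (- 1) (mode b (- 1) fock_vac))" for B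
    by (simp add: euler_def)
  with fock_degree_2_expansion[OF degree_two] show ?thesis
    by (simp add: omega_def)
qed

end
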